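(* Let $G$ be a locally compact abelian group, $H\subseteq G$ a compact open subgroup and $A\in\operatorname{Aut}(G)$ expansive with respect to $H$. If $\Lambda\subset G$, then the following conditions are equivalent: (i) $D^+(\Lambda)<\infty$; (ii) for some $n\in\mathbb{Z}$ there exists $N_n>0$ such that $\#\{\Lambda\cap Q_n(A^nc)\}\le N_n$ for all $c\in C$, where $C$ is a section for $G/H$. Additionally, if (ii) holds for some $n\in\mathbb{Z}$, it holds for every $n\in\mathbb{Z}$.
   Context: Locally compact abelian groups are Hausdorff and written additively. The Haar measure is normalized by $m_G(H)=1$. $\operatorname{Aut}(G)$ is the group of homeomorphic automorphisms of $G$; the modulus $|A|>0$ of $A\in\operatorname{Aut}(G)$ is defined by $m_G(AU)=|A|\,m_G(U)$ for Borel $U$. $A$ is expansive with respect to $H$ if $H\subsetneq AH$ and $\bigcap_{n\le0}A^nH=\{0\}$. For $n\in\mathbb{Z}$ and $x\in G$, $Q_n(x)=x+A^nH$. A section for $G/H$ is a set containing exactly one element of each coset of $H$ in $G$. The upper Beurling density of $\Lambda$ (with respect to $A$) is $$D^+(\Lambda)=D^+_A(\Lambda)=\limsup_{n\to+\infty}\frac{1}{|A|^n}\max_{x\in G}\#\{\Lambda\cap Q_n(x)\},$$ where the maximum may be $+\infty$. *)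

theory Defs
  imports "HOL-Analysis.Analysis"
begin

definition add_subgroup :: "'a::ab_group_add set \<Rightarrow> bool" where
  "add_subgroup H \<longleftrightarrow>
     0 \<in> H \<and> (\<forall>x\<in>H. \<forall>y\<in>H. x + y \<in> H) \<and> (\<forall>x\<in>H. - x \<in> H)"

definition topological_automorphism :: "('a::topological_ab_group_add \<Rightarrow> 'a) \<Rightarrow> bool" where
  "topological_automorphism A \<longleftrightarrow> Modules.additive A \<and> homeomorphism UNIV UNIV A (inv A)"

definition iterate :: "('a \<Rightarrow> 'a) \<Rightarrow> int \<Rightarrow> 'a \<Rightarrow> 'a" where
  "iterate A n = (if n \<ge> 0 then A ^^ nat n else inv A ^^ nat (- n))"

text \<open>Haar measure in the usual Radon sense. The group need not be sigma-compact, so the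
  regularity conditions are not automatic and are needed for uniqueness up to scaling.\<close>

definition haar_measure :: "'a::topological_ab_group_add measure \<Rightarrow> bool" where
  "haar_measure m \<longleftrightarrow>
     sets m = sets borel \<and>
     emeasure m (space m) \<noteq> 0 \<and>
     (\<forall>x. \<forall>U\<in>sets borel. emeasure m ((+) x ` U) = emeasure m U) \<and>
     (\<forall>K. compact K \<longrightarrow> emeasure m K < \<infinity>) \<and>
     (\<forall>U\<in>sets borel. emeasure m U = (INF V\<in>{V. open V \<and> U \<subseteq> V}. emeasure m V)) \<and>
     (\<forall>V. open V \<longrightarrow> emeasure m V = (SUP K\<in>{K. compact K \<and> K \<subseteq> V}. emeasure m K))"

definition modulus :: "'a::topological_ab_group_add measure \<Rightarrow> ('a \<Rightarrow> 'a) \<Rightarrow> real" where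
  "modulus m A =
     (THE r. r > 0 \<and> (\<forall>U\<in>sets borel. emeasure m (A ` U) = ennreal r * emeasure m U))"

definition expansive :: "'a::ab_group_add set \<Rightarrow> ('a \<Rightarrow> 'a) \<Rightarrow> bool" where
  "expansive H A \<longleftrightarrow> H \<subset> A ` H \<and> (\<Inter>n\<in>{..0}. iterate A n ` H) = {0}"

definition Q :: "'a::ab_group_add set \<Rightarrow> ('a \<Rightarrow> 'a) \<Rightarrow> int \<Rightarrow> 'a \<Rightarrow> 'a set" where
  "Q H A n x = (+) x ` (iterate A n ` H)"

definition is_section :: "'a::ab_group_add set \<Rightarrow> 'a set \<Rightarrow> bool" where
  "is_section H C \<longleftrightarrow> (\<forall>x. \<exists>!c. c \<in> C \<and> c \<in> (+) x ` H)"

text \<open>Number of elements, with value \<open>\<infinity>\<close> (rather than \<open>0\<close>, as for \<^const>\<open>card\<close>) on infinite sets.\<close>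

abbreviation ecount :: "'a set \<Rightarrow> ennreal" where
  "ecount X \<equiv> emeasure (count_space UNIV) X"

text \<open>The supremum below is a maximum: its entries are natural numbers or \<open>\<infinity>\<close>, so it is attained
  unless it is a supremum of unbounded counts, in which case the maximum is \<open>\<infinity>\<close> by convention.\<close>

definition upper_beurling_density ::
    "'a::topological_ab_group_add measure \<Rightarrow> 'a set \<Rightarrow> ('a \<Rightarrow> 'a) \<Rightarrow> 'a set \<Rightarrow> ennreal" where
  "upper_beurling_density m H A \<Lambda> =
     limsup (\<lambda>n::nat. ennreal (1 / modulus m A ^ n) * (SUP x. ecount (\<Lambda> \<inter> Q H A (int n) x)))"

definition uniformly_bounded_count ::
    "'a::ab_group_add set \<Rightarrow> ('a \<Rightarrow> 'a) \<Rightarrow> 'a set \<Rightarrow> 'a set \<Rightarrow> int \<Rightarrow> bool" where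
  "uniformly_bounded_count H A C \<Lambda> n \<longleftrightarrow>
     (\<exists>N::real. N > 0 \<and> (\<forall>c\<in>C. ecount (\<Lambda> \<inter> Q H A n (iterate A n c)) \<le> ennreal N))"

end

theory Submission
  imports Defs
begin

text \<open>
  Write \<open>S n\<close> for the supremum of the numbers of points of \<open>\<Lambda>\<close> in the cells \<open>Q H A n x\<close>.  As \<open>C\<close>
  represents all cosets of \<open>H\<close>, the sets \<open>Q H A n (A\<^sup>n c)\<close> with \<open>c \<in> C\<close> are all cosets of \<open>A\<^sup>n H\<close>, so
  condition (ii) at level \<open>n\<close> says precisely that \<open>S n\<close> is finite
  (\<open>uniformly_bounded_count_iff\<close>).  The compact group \<open>A H\<close> is a disjoint union of finitely many,
  say \<open>r\<close>, cosets of the open subgroup \<open>H\<close>.  Applying \<open>A\<^sup>n\<close>, every cell of level \<open>n + 1\<close> is a union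
  of \<open>r\<close> cells of level \<open>n\<close>, whence \<open>S n \<le> S (n + 1) \<le> r * S n\<close>.  Thus finiteness of \<open>S\<close> does not
  depend on the level, and \<open>S n \<le> r ^ n * S 0\<close> for \<open>n \<ge> 0\<close>.  If the modulus of \<open>A\<close> is \<open>r\<close>, it follows
  that the upper density is at most \<open>S 0\<close>; conversely, a finite density forces some \<open>S n\<close> to be
  finite.

  What remains is that \<open>A\<close> multiplies the measure of every Borel set by
  \<open>r\<close> (\<open>emeasure_image_borel\<close>). In general this is the uniqueness of Haar
  measure, but expansiveness gives a direct proof. The groups \<open>A\<^sup>-\<^sup>k H\<close>
  decrease to \<open>{0}\<close>, so by compactness they form a neighbourhood base at
  \<open>0\<close> (\<open>small_coset_subset\<close>). The scaling holds for cosets of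
  \<open>A\<^sup>-\<^sup>k H\<close>, since \<open>A\<close> maps them to unions of \<open>r\<close>
  cosets of the same group, and hence for finite unions of them. These approximate open sets from
  inside, so inner regularity gives the scaling for open sets, and outer regularity then gives it
  for Borel sets.
\<close>

section \<open>Scaling of infima\<close>

lemma INF_cmult_ennreal:
  fixes c :: ennreal
  assumes "I \<noteq> {}" "c < top"
  shows "(INF i\<in>I. c * f i) = c * (INF i\<in>I. f i)"
proof -
  have "continuous_on UNIV (\<lambda>x. c * x)"
    by (intro ennreal_continuous_on_cmult assms continuous_on_id)
  then have "continuous (at_right (Inf (f ` I))) (\<lambda>x. c * x)"
    by (auto intro: continuous_on_imp_continuous_within)
  moreover have "mono (\<lambda>x. c * x)" by (rule monoI) (simp add: mult_left_mono)
  ultimately have "c * Inf (f ` I) = Inf ((\<lambda>x. c * x) ` f ` I)"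
    using assms(1) by (intro continuous_at_Inf_mono) auto
  then show ?thesis by (simp add: image_image)
qed

section \<open>Cosets of a subgroup\<close>

lemma add_subgroup_zero: "add_subgroup L \<Longrightarrow> 0 \<in> L"
  by (simp add: add_subgroup_def)

lemma mem_coset_iff: "y \<in> (+) x ` L \<longleftrightarrow> y - x \<in> L" for x y :: "'a::ab_group_add"
  by (metis add.commute add_diff_cancel_left' diff_add_cancel image_iff)

lemma coset_eq:
  fixes L :: "'a::ab_group_add set"
  assumes L: "add_subgroup L" and "y \<in> (+) x ` L"
  shows "(+) y ` L = (+) x ` L"
proof -
  have yx: "y - x \<in> L" using assms by (simp add: mem_coset_iff)
  have sum: "\<And>a b. a \<in> L \<Longrightarrow> b \<in> L \<Longrightarrow> a + b \<in> L" and neg: "\<And>a. a \<in> L \<Longrightarrow> - a \<in> L"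
    using L by (auto simp: add_subgroup_def)
  have "z - y \<in> L \<longleftrightarrow> z - x \<in> L" for z
    using sum[of "z - y" "y - x"] sum[of "z - x" "- (y - x)"] yx neg[OF yx]
    by (auto simp: algebra_simps)
  then show ?thesis by (auto simp only: set_eq_iff mem_coset_iff)
qed

lemma coset_self: "add_subgroup L \<Longrightarrow> x \<in> (+) x ` L" for x :: "'a::ab_group_add"
  by (simp add: mem_coset_iff add_subgroup_zero)

lemma cosets_disjoint_or_eq:
  fixes L :: "'a::ab_group_add set"
  assumes "add_subgroup L"
  shows "(+) x ` L \<inter> (+) y ` L = {} \<or> (+) x ` L = (+) y ` L"
  using coset_eq[OF assms] by blast

text \<open>Members that are already covered can be dropped one after the other.\<close>

lemma finite_union_disjoint_subfamily:
  fixes g :: "'i \<Rightarrow> 'b set"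
  assumes "finite F" and g: "\<And>x y. g x \<inter> g y = {} \<or> g x = g y"
  shows "\<exists>F'\<subseteq>F. finite F' \<and> \<Union> (g ` F') = \<Union> (g ` F) \<and> disjoint_family_on g F'"
  using \<open>finite F\<close>
proof induction
  case empty
  then show ?case by (simp add: disjoint_family_on_def)
next
  case (insert x F)
  then obtain F' where F': "F' \<subseteq> F" "finite F'" "\<Union> (g ` F') = \<Union> (g ` F)"
    "disjoint_family_on g F'" by blast
  show ?case
  proof (cases "g x \<in> g ` F'")
    case True
    then have "\<Union> (g ` F') = \<Union> (g ` insert x F)"
      unfolding image_insert Union_insert F'(3)[symmetric] by blast
    moreover have "F' \<subseteq> insert x F" using F'(1) by blast
    ultimately show ?thesis using F'(2,4) by blast
  next
    case False
    then have "g x \<inter> \<Union> (g ` F') = {}" using g[of x] by blast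
    moreover have "x \<notin> F'" using False by blast
    ultimately have "disjoint_family_on g (insert x F')"
      using F'(4) by (simp add: disjoint_family_on_insert)
    moreover have "\<Union> (g ` insert x F') = \<Union> (g ` insert x F)"
      unfolding image_insert Union_insert F'(3) ..
    moreover have "insert x F' \<subseteq> insert x F" "finite (insert x F')" using F'(1,2) by auto
    ultimately show ?thesis by blast
  qed
qed

lemma open_coset:
  fixes U :: "'a::topological_ab_group_add set"
  assumes "open U" shows "open ((+) x ` U)"
proof -
  have "(+) x ` U = (\<lambda>y. y - x) -` U" by (auto simp: mem_coset_iff)
  moreover have "open ((\<lambda>y. y - x) -` U)"
    using assms by (intro open_vimage continuous_intros) auto
  ultimately show ?thesis by simp
qed

lemma compact_coset_cover:
  fixes L K :: "'a::topological_ab_group_add set"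
  assumes L: "add_subgroup L" "open L" and K: "compact K"
  obtains F where "F \<subseteq> K" "finite F" "K \<subseteq> (\<Union>x\<in>F. (+) x ` L)"
    "disjoint_family_on (\<lambda>x. (+) x ` L) F"
proof -
  have "K \<subseteq> (\<Union>x\<in>K. (+) x ` L)" using coset_self[OF L(1)] by blast
  then obtain F where F: "F \<subseteq> K" "finite F" "K \<subseteq> (\<Union>x\<in>F. (+) x ` L)"
    by (rule compactE_image[OF K open_coset[OF L(2)]])
  obtain F' where F': "F' \<subseteq> F" "finite F'" "(\<Union>x\<in>F'. (+) x ` L) = (\<Union>x\<in>F. (+) x ` L)"
    "disjoint_family_on (\<lambda>x. (+) x ` L) F'"
    using finite_union_disjoint_subfamily[where g = "\<lambda>x. (+) x ` L", OF F(2) cosets_disjoint_or_eq[OF L(1)]]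
    by (elim exE conjE)
  have "F' \<subseteq> K" using F'(1) F(1) by (rule order_trans)
  moreover have "K \<subseteq> (\<Union>x\<in>F'. (+) x ` L)" unfolding F'(3) by (rule F(3))
  ultimately show thesis using F'(2,4) by (intro that[of F'])
qed

section \<open>Iterates of an automorphism\<close>

lemma topological_automorphismD:
  fixes A :: "'a::topological_ab_group_add \<Rightarrow> 'a"
  assumes "topological_automorphism A"
  shows "A (x + y) = A x + A y" "bij A" "continuous_on UNIV A" "continuous_on UNIV (inv A)"
proof -
  have h: "homeomorphism UNIV UNIV A (inv A)"
    using assms by (simp add: topological_automorphism_def)
  show "A (x + y) = A x + A y"
    using assms by (simp add: topological_automorphism_def Modules.additive.add)
  show "bij A" using h unfolding homeomorphism_def by (metis bijI' UNIV_I)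
  show "continuous_on UNIV A" "continuous_on UNIV (inv A)" using h by (auto simp: homeomorphism_def)
qed

lemma topological_automorphismI:
  fixes A :: "'a::topological_ab_group_add \<Rightarrow> 'a"
  assumes "\<And>x y. A (x + y) = A x + A y" "bij A" "continuous_on UNIV A" "continuous_on UNIV (inv A)"
  shows "topological_automorphism A"
  using assms unfolding topological_automorphism_def homeomorphism_def
  by (auto simp: Modules.additive_def bij_is_surj bij_is_inj bij_imp_bij_inv surj_f_inv_f)

lemma topological_automorphism_inv:
  fixes A :: "'a::topological_ab_group_add \<Rightarrow> 'a"
  assumes "topological_automorphism A" shows "topological_automorphism (inv A)"
proof (rule topological_automorphismI)
  note A = topological_automorphismD[OF assms]
  show "inv A (x + y) = inv A x + inv A y" for x y
    using A(1)[of "inv A x" "inv A y"] A(2) by (metis bij_inv_eq_iff)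
qed (use topological_automorphismD[OF assms] in \<open>auto simp: bij_imp_bij_inv inv_inv_eq\<close>)

lemma topological_automorphism_comp:
  fixes A B :: "'a::topological_ab_group_add \<Rightarrow> 'a"
  assumes "topological_automorphism A" "topological_automorphism B"
  shows "topological_automorphism (A \<circ> B)"
proof (rule topological_automorphismI)
  note A = topological_automorphismD[OF assms(1)] and B = topological_automorphismD[OF assms(2)]
  show "(A \<circ> B) (x + y) = (A \<circ> B) x + (A \<circ> B) y" for x y by (simp add: A B)
  show "bij (A \<circ> B)" by (rule bij_comp[OF B(2) A(2)])
  show "continuous_on UNIV (A \<circ> B)"
    by (rule continuous_on_compose[OF B(3) continuous_on_subset[OF A(3) subset_UNIV]])
  show "continuous_on UNIV (inv (A \<circ> B))"
    unfolding o_inv_distrib[OF A(2) B(2)]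
    by (rule continuous_on_compose[OF A(4) continuous_on_subset[OF B(4) subset_UNIV]])
qed

lemma topological_automorphism_id: "topological_automorphism (id :: 'a::topological_ab_group_add \<Rightarrow> 'a)"
  by (rule topological_automorphismI) (auto simp: continuous_on_id)

lemma topological_automorphism_iterate:
  fixes A :: "'a::topological_ab_group_add \<Rightarrow> 'a"
  assumes "topological_automorphism A" shows "topological_automorphism (iterate A n)"
proof -
  have "topological_automorphism (B ^^ k)" if "topological_automorphism B"
    for B :: "'a \<Rightarrow> 'a" and k
  proof (induction k)
    case 0
    show ?case using topological_automorphism_id by (simp add: id_def)
  next
    case (Suc k)
    then show ?case unfolding funpow.simps by (rule topological_automorphism_comp[OF that])
  qed
  then show ?thesis using assms topological_automorphism_inv[OF assms] by (simp add: iterate_def)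
qed

lemma iterate_plus_one:
  assumes "bij A"
  shows "iterate A (n + 1) x = A (iterate A n x)" "iterate A (n + 1) x = iterate A n (A x)"
proof -
  have "iterate A (n + 1) x = A (iterate A n x) \<and> iterate A (n + 1) x = iterate A n (A x)"
  proof (cases "n \<ge> 0")
    case True
    then have "nat (n + 1) = Suc (nat n)" by simp
    then have i: "iterate A (n + 1) = A ^^ Suc (nat n)" "iterate A n = A ^^ nat n"
      using True by (simp_all only: iterate_def) simp_all
    show ?thesis unfolding i by (metis comp_apply funpow.simps(2) funpow_Suc_right)
  next
    case False
    define k where "k = nat (- n - 1)"
    have n: "nat (- n) = Suc k" "nat (- (n + 1)) = k" using False by (simp_all add: k_def)
    have i: "iterate A n = inv A ^^ Suc k" using n(1) False by (simp only: iterate_def if_False)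
    have i': "iterate A (n + 1) = inv A ^^ k"
    proof (cases "n + 1 = 0")
      case True
      then have "k = 0" using n(2) by simp
      then show ?thesis using True by (simp add: iterate_def)
    next
      case nz: False
      then have "\<not> 0 \<le> n + 1" using False by simp
      then show ?thesis using n(2) by (simp only: iterate_def if_False)
    qed
    have inv: "A (inv A y) = y" "inv A (A y) = y" for y
      using assms by (auto simp: bij_is_surj surj_f_inv_f bij_is_inj)
    have "A ((inv A ^^ Suc k) x) = (inv A ^^ k) x"
      by (simp only: funpow.simps comp_apply inv)
    moreover have "(inv A ^^ Suc k) (A x) = (inv A ^^ k) x"
      by (simp only: funpow_Suc_right comp_apply inv)
    ultimately show ?thesis unfolding i i' by (simp only: simp_thms)
  qed
  then show "iterate A (n + 1) x = A (iterate A n x)" "iterate A (n + 1) x = iterate A n (A x)"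
    by auto
qed

lemma compact_automorphism_image:
  fixes A :: "'a::topological_ab_group_add \<Rightarrow> 'a"
  assumes "topological_automorphism A" "compact K" shows "compact (A ` K)"
  using topological_automorphismD(3)[OF assms(1)] assms(2)
  by (metis compact_continuous_image continuous_on_subset subset_UNIV)

lemma
  fixes A :: "'a::topological_ab_group_add \<Rightarrow> 'a"
  assumes "topological_automorphism A"
  shows open_automorphism_image: "open U \<Longrightarrow> open (A ` U)"
    and borel_automorphism_image: "U \<in> sets borel \<Longrightarrow> A ` U \<in> sets borel"
proof -
  note A = topological_automorphismD[OF assms]
  have eq: "A ` U = inv A -` U"
    using bij_vimage_eq_inv_image[OF bij_imp_bij_inv[OF A(2)], of U] by (simp only: inv_inv_eq[OF A(2)])
  show "open U \<Longrightarrow> open (A ` U)" unfolding eq by (rule open_vimage[OF _ A(4)])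
  have "inv A \<in> borel_measurable borel" by (rule borel_measurable_continuous_onI[OF A(4)])
  then show "U \<in> sets borel \<Longrightarrow> A ` U \<in> sets borel"
    unfolding eq using measurable_sets[of "inv A" borel borel U] by simp
qed

lemma add_subgroup_automorphism_image:
  fixes A :: "'a::topological_ab_group_add \<Rightarrow> 'a"
  assumes "topological_automorphism A" "add_subgroup L" shows "add_subgroup (A ` L)"
proof -
  have A: "A (x + y) = A x + A y" "A 0 = 0" "A (- x) = - A x" for x y
    using assms(1) Modules.additive.add Modules.additive.zero Modules.additive.minus
    unfolding topological_automorphism_def by blast+
  show ?thesis
    unfolding add_subgroup_def
  proof (intro conjI ballI)
    show "0 \<in> A ` L" using A(2) add_subgroup_zero[OF assms(2)] by (metis image_eqI)
  next
    fix x y assume "x \<in> A ` L" "y \<in> A ` L"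
    then obtain a b where "a \<in> L" "b \<in> L" "x + y = A (a + b)" by (auto simp: A(1))
    then show "x + y \<in> A ` L" using assms(2) by (auto simp: add_subgroup_def)
  next
    fix x assume "x \<in> A ` L"
    then obtain a where "a \<in> L" "- x = A (- a)" by (auto simp: A(3))
    then show "- x \<in> A ` L" using assms(2) by (auto simp: add_subgroup_def)
  qed
qed

lemma automorphism_image_coset:
  fixes A :: "'a::topological_ab_group_add \<Rightarrow> 'a"
  assumes "topological_automorphism A" shows "A ` ((+) x ` L) = (+) (A x) ` (A ` L)"
  by (simp only: image_image topological_automorphismD(1)[OF assms])

lemma automorphism_image_disjoint_cosets:
  fixes A :: "'a::topological_ab_group_add \<Rightarrow> 'a"
  assumes "topological_automorphism A" "disjoint_family_on (\<lambda>x. (+) x ` L) F"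
  shows "disjoint_family_on (\<lambda>x. (+) (A x) ` (A ` L)) F"
proof -
  have "A ` X \<inter> A ` Y = {}" if "X \<inter> Y = {}" for X Y
    using that topological_automorphismD(2)[OF assms(1)] by (metis bij_is_inj image_Int image_empty)
  then show ?thesis
    using assms(2)
    unfolding disjoint_family_on_def automorphism_image_coset[OF assms(1), symmetric] by meson
qed

section \<open>The cells of an expansive automorphism\<close>

locale expansive_automorphism =
  fixes H :: "'a::{topological_ab_group_add, t2_space} set" and A :: "'a \<Rightarrow> 'a"
  assumes H_subgroup: "add_subgroup H" and H_compact: "compact H" and H_open: "open H"
    and automorphism: "topological_automorphism A" and expansive: "expansive H A"
begin

abbreviation dil :: "int \<Rightarrow> 'a set" where "dil n \<equiv> iterate A n ` H"

lemma bij: "bij A" by (rule topological_automorphismD(2)[OF automorphism])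

lemma automorphism_iterate: "topological_automorphism (iterate A n)"
  by (rule topological_automorphism_iterate[OF automorphism])

lemma dil_subgroup: "add_subgroup (dil n)"
  and dil_compact: "compact (dil n)"
  and dil_open: "open (dil n)"
  using automorphism_iterate[of n] H_subgroup H_compact H_open
  by (auto intro: add_subgroup_automorphism_image compact_automorphism_image
      open_automorphism_image)

lemma dil_plus_one: "dil (n + 1) = A ` dil n" "dil (n + 1) = iterate A n ` (A ` H)"
  by (simp_all only: image_image flip: iterate_plus_one[OF bij])

lemma dil_mono: "m \<le> n \<Longrightarrow> dil m \<subseteq> dil n"
proof (induction n rule: int_ge_induct)
  case (step n)
  have "H \<subseteq> A ` H" using expansive by (auto simp: expansive_def)
  then have "dil n \<subseteq> dil (n + 1)" unfolding dil_plus_one(2) by (rule image_mono)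
  then show ?case using step by blast
qed auto

text \<open>In a compact space, open neighbourhoods of the intersection of a decreasing sequence of closed
  sets contain one of its members.\<close>

lemma small_coset_subset:
  assumes "open V" "x \<in> V"
  obtains k :: nat where "(+) x ` dil (- int k) \<subseteq> V"
proof -
  \<comment> \<open>Translating \<open>V\<close> by \<open>- x\<close> reduces the claim to a neighbourhood of \<open>0\<close>.\<close>
  define V0 where "V0 = (+) (- x) ` V"
  have V0: "open V0" unfolding V0_def by (rule open_coset[OF assms(1)])
  have V0_iff: "y \<in> V0 \<longleftrightarrow> x + y \<in> V" for y
    unfolding V0_def mem_coset_iff by (simp add: add.commute)
  have "0 \<in> V0" using assms(2) V0_iff[of 0] by simp
  have cover: "H \<subseteq> (\<Union>k\<in>UNIV. V0 \<union> - dil (- int k))"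
  proof
    fix y
    show "y \<in> (\<Union>k\<in>UNIV. V0 \<union> - dil (- int k))"
    proof (cases "y = 0")
      case False
      then have "y \<notin> (\<Inter>n\<in>{..0}. dil n)" using expansive by (simp add: expansive_def)
      then obtain n where "n \<le> 0" "y \<notin> dil n" by auto
      then have "y \<notin> dil (- int (nat (- n)))" by simp
      then show ?thesis by blast
    qed (use \<open>0 \<in> V0\<close> in auto)
  qed
  have open_V0: "open (V0 \<union> - dil (- int k))" for k
    using V0 compact_imp_closed[OF dil_compact, of "- int k"] by (simp only: open_Un open_Compl)
  obtain I where I: "finite I" "H \<subseteq> (\<Union>k\<in>I. V0 \<union> - dil (- int k))"
    by (rule compactE_image[OF H_compact open_V0 cover])
  obtain k where k: "\<forall>i\<in>I. i \<le> k" using I(1) finite_nat_set_iff_bounded_le by blast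
  have H: "dil 0 = H" by (simp add: iterate_def)
  have "dil (- int k) \<subseteq> V0"
  proof
    fix y assume y: "y \<in> dil (- int k)"
    then have "y \<in> H" using dil_mono[of "- int k" 0] H by auto
    then obtain i where "i \<in> I" "y \<in> V0 \<or> y \<notin> dil (- int i)" using I by blast
    then show "y \<in> V0" using k y dil_mono[of "- int k" "- int i"] by auto
  qed
  then have "(+) x ` dil (- int k) \<subseteq> V" using V0_iff by blast
  then show thesis by (rule that)
qed

text \<open>The sets of points whose coset of \<open>A\<^sup>-\<^sup>k H\<close> lies in \<open>V\<close> are open and increase to \<open>V\<close>, so one of them
  contains \<open>K\<close>.\<close>

lemma compact_subset_open_coset_union:
  assumes K: "compact K" and V: "open V" "K \<subseteq> V"
  obtains k F where "finite F" "disjoint_family_on (\<lambda>x. (+) x ` dil (- int k)) F"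
    "K \<subseteq> (\<Union>x\<in>F. (+) x ` dil (- int k))" "(\<Union>x\<in>F. (+) x ` dil (- int k)) \<subseteq> V"
proof -
  define U where "U k = {x. (+) x ` dil (- int k) \<subseteq> V}" for k
  have U_iff: "x \<in> U k \<longleftrightarrow> (+) x ` dil (- int k) \<subseteq> V" for x k
    by (simp only: U_def mem_Collect_eq)
  have open_U: "open (U k)" for k
  proof -
    have union: "U k = (\<Union>x\<in>U k. (+) x ` dil (- int k))"
    proof
      show "U k \<subseteq> (\<Union>x\<in>U k. (+) x ` dil (- int k))"
      proof
        fix x assume "x \<in> U k"
        then show "x \<in> (\<Union>x\<in>U k. (+) x ` dil (- int k))"
          using coset_self[OF dil_subgroup] by (rule UN_I)
      qed
      have "y \<in> U k" if "x \<in> U k" "y \<in> (+) x ` dil (- int k)" for x y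
        using that(1) unfolding U_iff coset_eq[OF dil_subgroup that(2)] .
      then show "(\<Union>x\<in>U k. (+) x ` dil (- int k)) \<subseteq> U k" by blast
    qed
    show ?thesis by (subst union) (intro open_UN ballI open_coset dil_open)
  qed
  have cover: "K \<subseteq> (\<Union>k\<in>UNIV. U k)"
  proof
    fix x assume "x \<in> K"
    then have "x \<in> V" using V(2) by blast
    then obtain k where "(+) x ` dil (- int k) \<subseteq> V" by (rule small_coset_subset[OF V(1)])
    then have "x \<in> U k" by (simp only: U_iff)
    then show "x \<in> (\<Union>k\<in>UNIV. U k)" by blast
  qed
  have "\<exists>I. finite I \<and> K \<subseteq> (\<Union>k\<in>I. U k)"
    by (rule compactE_image[where C = UNIV and f = U, OF K open_U cover]) (intro exI conjI)
  then obtain I where I: "finite I" "K \<subseteq> (\<Union>k\<in>I. U k)" by (elim exE conjE)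
  obtain k where k: "\<forall>i\<in>I. i \<le> k" using I(1) finite_nat_set_iff_bounded_le by blast
  have KU: "K \<subseteq> U k"
  proof
    fix x assume "x \<in> K"
    then obtain i where i: "i \<in> I" "x \<in> U i" using I by blast
    then have "dil (- int k) \<subseteq> dil (- int i)" using k by (intro dil_mono) auto
    then have "(+) x ` dil (- int k) \<subseteq> (+) x ` dil (- int i)" by (rule image_mono)
    then show "x \<in> U k" using i(2) unfolding U_iff by (rule order_trans)
  qed
  obtain F where F: "F \<subseteq> K" "finite F" "K \<subseteq> (\<Union>x\<in>F. (+) x ` dil (- int k))"
    "disjoint_family_on (\<lambda>x. (+) x ` dil (- int k)) F"
    by (rule compact_coset_cover[OF dil_subgroup dil_open K])
  have "(+) x ` dil (- int k) \<subseteq> V" if "x \<in> F" for x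
    using subsetD[OF order_trans[OF F(1) KU] that] by (simp only: U_iff)
  then have "(\<Union>x\<in>F. (+) x ` dil (- int k)) \<subseteq> V" by (rule UN_least)
  then show thesis by (rule that[OF F(2,4,3)])
qed

definition transversal :: "'a set \<Rightarrow> bool" where
  "transversal F \<longleftrightarrow> finite F \<and> A ` H = (\<Union>x\<in>F. (+) x ` H) \<and> disjoint_family_on (\<lambda>x. (+) x ` H) F"

lemma transversal_exists: obtains F where "transversal F"
proof -
  obtain F where F: "F \<subseteq> A ` H" "finite F" "A ` H \<subseteq> (\<Union>x\<in>F. (+) x ` H)"
    "disjoint_family_on (\<lambda>x. (+) x ` H) F"
    using compact_coset_cover[OF H_subgroup H_open compact_automorphism_image[OF automorphism H_compact]]
    by blast
  have "add_subgroup (A ` H)" by (rule add_subgroup_automorphism_image[OF automorphism H_subgroup])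
  moreover have "H \<subseteq> A ` H" using expansive by (auto simp: expansive_def)
  ultimately have "x + h \<in> A ` H" if "x \<in> F" "h \<in> H" for x h
    using F(1) that unfolding add_subgroup_def by blast
  then have "(\<Union>x\<in>F. (+) x ` H) \<subseteq> A ` H" by blast
  with F(3) have "A ` H = (\<Union>x\<in>F. (+) x ` H)" by (rule antisym)
  then have "transversal F" unfolding transversal_def using F(2,4) by (intro conjI)
  then show thesis by (rule that)
qed

lemma transversal_card_pos: "transversal F \<Longrightarrow> card F > 0"
  using add_subgroup_zero[OF H_subgroup] by (auto simp: transversal_def card_gt_0_iff)

lemma transversal_dil:
  assumes "transversal F"
  shows "dil (n + 1) = (\<Union>x\<in>F. (+) (iterate A n x) ` dil n)"
    "disjoint_family_on (\<lambda>x. (+) (iterate A n x) ` dil n) F"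
proof -
  have "dil (n + 1) = (\<Union>x\<in>F. iterate A n ` ((+) x ` H))"
    using assms by (simp add: dil_plus_one(2) transversal_def image_UN)
  then show "dil (n + 1) = (\<Union>x\<in>F. (+) (iterate A n x) ` dil n)"
    by (simp add: automorphism_image_coset[OF automorphism_iterate])
  show "disjoint_family_on (\<lambda>x. (+) (iterate A n x) ` dil n) F"
    using assms by (intro automorphism_image_disjoint_cosets[OF automorphism_iterate])
      (simp add: transversal_def)
qed

section \<open>The modulus as an index\<close>

context
  fixes m :: "'a measure"
  assumes haar: "haar_measure m"
begin

lemma sets_m [simp]: "sets m = sets borel" using haar by (simp add: haar_measure_def)

lemma emeasure_translate: "U \<in> sets borel \<Longrightarrow> emeasure m ((+) x ` U) = emeasure m U"
  using haar by (simp add: haar_measure_def)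

lemma emeasure_disjoint_cosets:
  assumes "finite F" "disjoint_family_on (\<lambda>x. (+) (g x) ` L) F" "open L"
  shows "emeasure m (\<Union>x\<in>F. (+) (g x) ` L) = of_nat (card F) * emeasure m L"
proof -
  have "emeasure m (\<Union>x\<in>F. (+) (g x) ` L) = (\<Sum>x\<in>F. emeasure m ((+) (g x) ` L))"
    using assms by (intro sum_emeasure[symmetric]) (auto intro: borel_open open_coset)
  then show ?thesis using assms by (simp add: emeasure_translate)
qed

text \<open>Both \<open>A (A\<^sup>n H) = A\<^sup>n\<^sup>+\<^sup>1 H\<close> and its decomposition into translates of \<open>A\<^sup>n H\<close> arise from \<open>A H\<close> by
  applying \<open>A\<^sup>n\<close>, so the scaling factor is the index of \<open>H\<close> in \<open>A H\<close> at every level.\<close>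

lemma emeasure_image_dil:
  assumes "transversal F"
  shows "emeasure m (A ` dil n) = of_nat (card F) * emeasure m (dil n)"
  using emeasure_disjoint_cosets[OF _ transversal_dil(2)[OF assms, of n] dil_open] assms
  by (simp add: transversal_dil(1)[OF assms] transversal_def flip: dil_plus_one(1))

lemma emeasure_image_coset_union:
  assumes "transversal F" "finite E" "disjoint_family_on (\<lambda>x. (+) x ` dil n) E"
  shows "emeasure m (A ` (\<Union>x\<in>E. (+) x ` dil n)) =
    of_nat (card F) * emeasure m (\<Union>x\<in>E. (+) x ` dil n)"
proof -
  have "emeasure m (A ` (\<Union>x\<in>E. (+) x ` dil n)) = of_nat (card E) * emeasure m (A ` dil n)"
    unfolding image_UN automorphism_image_coset[OF automorphism]
    using assms(2) automorphism_image_disjoint_cosets[OF automorphism assms(3)]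
      open_automorphism_image[OF automorphism dil_open] by (rule emeasure_disjoint_cosets)
  moreover have "emeasure m (\<Union>x\<in>E. (+) x ` dil n) = of_nat (card E) * emeasure m (dil n)"
    using emeasure_disjoint_cosets[of E "\<lambda>x. x" "dil n"] assms dil_open by simp
  ultimately show ?thesis by (simp add: emeasure_image_dil[OF assms(1)] mult.left_commute)
qed

text \<open>Between a compact \<open>K\<close> and an open \<open>V\<close> containing it lies a finite union of small cosets, for which
  the scaling is known; inner regularity of \<open>V\<close> gives one inequality, that of \<open>A V\<close> the other.\<close>

lemma emeasure_image_open:
  assumes F: "transversal F" and V: "open V"
  shows "emeasure m (A ` V) = of_nat (card F) * emeasure m V"
proof (rule antisym)
  have "\<forall>V. open V \<longrightarrow> emeasure m V = (SUP K\<in>{K. compact K \<and> K \<subseteq> V}. emeasure m K)"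
    using haar unfolding haar_measure_def by (elim conjE)
  then have inner: "emeasure m U = (SUP K\<in>{K. compact K \<and> K \<subseteq> U}. emeasure m K)"
    if "open U" for U using that by (elim allE[of _ U] mp)
  have AV: "open (A ` V)" by (rule open_automorphism_image[OF automorphism V])
  have *: "emeasure m (A ` K) \<le> of_nat (card F) * emeasure m V"
    "of_nat (card F) * emeasure m K \<le> emeasure m (A ` V)"
    if K: "compact K" "K \<subseteq> V" for K
  proof -
    obtain k E where E: "finite E" "disjoint_family_on (\<lambda>x. (+) x ` dil (- int k)) E"
      "K \<subseteq> (\<Union>x\<in>E. (+) x ` dil (- int k))" "(\<Union>x\<in>E. (+) x ` dil (- int k)) \<subseteq> V"
      by (rule compact_subset_open_coset_union[OF K(1) V K(2)])
    define W where "W = (\<Union>x\<in>E. (+) x ` dil (- int k))"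
    have W: "emeasure m (A ` W) = of_nat (card F) * emeasure m W" "K \<subseteq> W" "W \<subseteq> V"
      unfolding W_def by (rule emeasure_image_coset_union[OF F E(1,2)], rule E(3), rule E(4))
    have "open W" unfolding W_def by (intro open_UN ballI open_coset dil_open)
    then have meas: "W \<in> sets m" "A ` W \<in> sets m" "V \<in> sets m" "A ` V \<in> sets m"
      using V AV open_automorphism_image[OF automorphism] by auto
    have "emeasure m (A ` K) \<le> emeasure m (A ` W)" using W meas by (intro emeasure_mono) auto
    also have "\<dots> \<le> of_nat (card F) * emeasure m V"
      unfolding W(1) using W meas by (intro mult_left_mono emeasure_mono) auto
    finally show "emeasure m (A ` K) \<le> of_nat (card F) * emeasure m V" .
    have "of_nat (card F) * emeasure m K \<le> emeasure m (A ` W)"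
      unfolding W(1) using W meas by (intro mult_left_mono emeasure_mono) auto
    also have "\<dots> \<le> emeasure m (A ` V)" using W meas by (intro emeasure_mono) auto
    finally show "of_nat (card F) * emeasure m K \<le> emeasure m (A ` V)" .
  qed
  show "emeasure m (A ` V) \<le> of_nat (card F) * emeasure m V"
    unfolding inner[OF AV]
  proof (rule SUP_least, clarify)
    fix L assume L: "compact L" "L \<subseteq> A ` V"
    have "A ` (inv A ` L) = L" by (simp add: image_f_inv_f bij bij_is_surj)
    moreover have "compact (inv A ` L)"
      by (rule compact_automorphism_image[OF topological_automorphism_inv[OF automorphism] L(1)])
    moreover have "inv A ` L \<subseteq> V" using L(2) bij by (auto simp: bij_is_inj)
    ultimately show "emeasure m L \<le> of_nat (card F) * emeasure m V"
      using *(1)[of "inv A ` L"] by (simp only: simp_thms)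
  qed
  show "of_nat (card F) * emeasure m V \<le> emeasure m (A ` V)"
    
    unfolding inner[OF V] SUP_mult_left_ennreal
  proof (rule SUP_least, clarify)
    fix K assume "compact K" "K \<subseteq> V"
    then show "of_nat (card F) * emeasure m K \<le> emeasure m (A ` V)" by (rule *(2))
  qed
qed

text \<open>The open neighbourhoods of \<open>A U\<close> are the images of those of \<open>U\<close>, so outer regularity carries the
  scaling from open sets to \<open>U\<close>.\<close>

lemma emeasure_image_borel:
  assumes F: "transversal F" and U: "U \<in> sets borel"
  shows "emeasure m (A ` U) = of_nat (card F) * emeasure m U"
proof -
  have "\<forall>U\<in>sets borel. emeasure m U = (INF V\<in>{V. open V \<and> U \<subseteq> V}. emeasure m V)"
    using haar unfolding haar_measure_def by (elim conjE)
  then have outer: "emeasure m U = (INF V\<in>{V. open V \<and> U \<subseteq> V}. emeasure m V)"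
    if "U \<in> sets borel" for U using that by (rule bspec)
  have eq: "{V. open V \<and> A ` U \<subseteq> V} = (`) A ` {V. open V \<and> U \<subseteq> V}"
  proof (rule set_eqI, rule iffI)
    fix V assume "V \<in> {V. open V \<and> A ` U \<subseteq> V}"
    then have V: "open V" "A ` U \<subseteq> V" by auto
    have "open (inv A ` V)"
      by (rule open_automorphism_image[OF topological_automorphism_inv[OF automorphism] V(1)])
    moreover have "U \<subseteq> inv A ` V" using V(2) bij by (force simp: bij_is_inj image_iff)
    moreover have "V = A ` (inv A ` V)" by (simp add: image_f_inv_f bij bij_is_surj)
    ultimately show "V \<in> (`) A ` {V. open V \<and> U \<subseteq> V}" by blast
  qed (auto intro: open_automorphism_image[OF automorphism])
  have "emeasure m (A ` U) = (INF V\<in>{V. open V \<and> U \<subseteq> V}. emeasure m (A ` V))"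
    by (simp add: outer[OF borel_automorphism_image[OF automorphism U]] eq image_image)
  also have "\<dots> = (INF V\<in>{V. open V \<and> U \<subseteq> V}. of_nat (card F) * emeasure m V)"
    by (intro INF_cong) (auto simp: emeasure_image_open[OF F])
  also have "\<dots> = of_nat (card F) * emeasure m U"
    unfolding outer[OF U]
    by (rule INF_cmult_ennreal) (auto simp: of_nat_less_top)
  finally show ?thesis .
qed

text \<open>The existence half of the definite description is the scaling just proved; evaluating at \<open>H\<close>,
  where the measure is neither \<open>0\<close> nor \<open>\<infinity>\<close>, gives uniqueness.\<close>

lemma modulus_eq_card:
  assumes F: "transversal F" and H: "emeasure m H = 1"
  shows "modulus m A = real (card F)"
  unfolding modulus_def
proof (rule the_equality)
  show "real (card F) > 0 \<and>
      (\<forall>U\<in>sets borel. emeasure m (A ` U) = ennreal (real (card F)) * emeasure m U)"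
    using transversal_card_pos[OF F] emeasure_image_borel[OF F] by (simp add: ennreal_of_nat_eq_real_of_nat)
next
  fix r :: real
  assume r: "r > 0 \<and> (\<forall>U\<in>sets borel. emeasure m (A ` U) = ennreal r * emeasure m U)"
  have Hb: "H \<in> sets borel" using H_open by simp
  have "ennreal r = ennreal (real (card F))"
    using r Hb emeasure_image_borel[OF F Hb] H by (simp add: ennreal_of_nat_eq_real_of_nat)
  then show "r = real (card F)" using r by simp
qed

end

section \<open>Counting points in cells\<close>

abbreviation max_count :: "'a set \<Rightarrow> int \<Rightarrow> ennreal" where
  "max_count \<Lambda> n \<equiv> (SUP x. ecount (\<Lambda> \<inter> Q H A n x))"

lemma max_count_mono: "max_count \<Lambda> n \<le> max_count \<Lambda> (n + 1)"
proof (rule SUP_mono')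
  fix x
  have "Q H A n x \<subseteq> Q H A (n + 1) x" unfolding Q_def by (intro image_mono dil_mono) simp
  then show "ecount (\<Lambda> \<inter> Q H A n x) \<le> ecount (\<Lambda> \<inter> Q H A (n + 1) x)"
    by (intro emeasure_mono) auto
qed

text \<open>Translating the decomposition of \<open>A\<^sup>n\<^sup>+\<^sup>1 H\<close> shows that a cell of level \<open>n + 1\<close> consists of \<open>card F\<close>
  cells of level \<open>n\<close>.\<close>

lemma max_count_le:
  assumes F: "transversal F"
  shows "max_count \<Lambda> (n + 1) \<le> of_nat (card F) * max_count \<Lambda> n"
proof (rule SUP_least)
  fix x
  have fin: "finite F" using F by (simp add: transversal_def)
  have "Q H A (n + 1) x = (\<Union>y\<in>F. Q H A n (x + iterate A n y))"
    unfolding Q_def transversal_dil(1)[OF F] by (simp add: image_UN image_image add.assoc)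
  then have "ecount (\<Lambda> \<inter> Q H A (n + 1) x) = ecount (\<Union>y\<in>F. \<Lambda> \<inter> Q H A n (x + iterate A n y))"
    by simp
  also have "\<dots> \<le> (\<Sum>y\<in>F. ecount (\<Lambda> \<inter> Q H A n (x + iterate A n y)))"
    by (rule emeasure_subadditive_finite[OF fin]) auto
  also have "\<dots> \<le> (\<Sum>y\<in>F. max_count \<Lambda> n)" by (intro sum_mono SUP_upper) auto
  finally show "ecount (\<Lambda> \<inter> Q H A (n + 1) x) \<le> of_nat (card F) * max_count \<Lambda> n" by simp
qed

lemma max_count_le_power:
  assumes F: "transversal F"
  shows "max_count \<Lambda> (int n) \<le> of_nat (card F) ^ n * max_count \<Lambda> 0"
proof (induction n)
  case (Suc n)
  have "max_count \<Lambda> (int (Suc n)) \<le> of_nat (card F) * max_count \<Lambda> (int n)"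
    using max_count_le[OF F, of \<Lambda> "int n"] by (simp add: add.commute)
  also have "\<dots> \<le> of_nat (card F) * (of_nat (card F) ^ n * max_count \<Lambda> 0)"
    by (intro mult_left_mono Suc) auto
  finally show ?case by (simp add: mult.assoc)
qed simp

lemma max_count_finite_iff: "max_count \<Lambda> n < \<infinity> \<longleftrightarrow> max_count \<Lambda> k < \<infinity>"
proof -
  obtain F where F: "transversal F" by (rule transversal_exists)
  have step: "max_count \<Lambda> i < \<infinity> \<longleftrightarrow> max_count \<Lambda> (i + 1) < \<infinity>" for i
  proof
    assume "max_count \<Lambda> i < \<infinity>"
    then have "of_nat (card F) * max_count \<Lambda> i < \<infinity>"
      by (simp add: ennreal_mult_less_top of_nat_less_top)
    then show "max_count \<Lambda> (i + 1) < \<infinity>" using max_count_le[OF F, of \<Lambda> i] by (rule le_less_trans[rotated])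
  qed (rule le_less_trans[OF max_count_mono])
  have "max_count \<Lambda> i < \<infinity> \<longleftrightarrow> max_count \<Lambda> 0 < \<infinity>" for i
  proof (induction i rule: int_induct[where k = 0])
    case (step1 i)
    then show ?case using step[of i] by blast
  next
    case (step2 i)
    then show ?case using step[of "i - 1"] by simp
  qed (rule refl)
  then show ?thesis by blast
qed

text \<open>Every cell of level \<open>n\<close> is \<open>A\<^sup>n (z + H)\<close> for some \<open>z\<close>, and \<open>C\<close> contains a representative of \<open>z + H\<close>;
  hence the bound at the points \<open>A\<^sup>n c\<close> is a bound for all cells.\<close>

lemma uniformly_bounded_count_iff:
  assumes C: "is_section H C"
  shows "uniformly_bounded_count H A C \<Lambda> n \<longleftrightarrow> max_count \<Lambda> n < \<infinity>"
proof
  assume "uniformly_bounded_count H A C \<Lambda> n"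
  then obtain N where N: "\<And>c. c \<in> C \<Longrightarrow> ecount (\<Lambda> \<inter> Q H A n (iterate A n c)) \<le> ennreal N"
    by (auto simp: uniformly_bounded_count_def)
  have "max_count \<Lambda> n \<le> ennreal N"
  proof (rule SUP_least)
    fix x
    obtain z where z: "x = iterate A n z"
      using topological_automorphismD(2)[OF automorphism_iterate, of n] by (metis bij_pointE)
    obtain c where c: "c \<in> C" "c \<in> (+) z ` H" using C unfolding is_section_def by blast
    have "iterate A n c \<in> (+) x ` dil n"
      unfolding z automorphism_image_coset[OF automorphism_iterate, symmetric] using c by blast
    then have "Q H A n (iterate A n c) = Q H A n x"
      unfolding Q_def by (rule coset_eq[OF dil_subgroup])
    then show "ecount (\<Lambda> \<inter> Q H A n x) \<le> ennreal N" using N[OF c(1)] by simp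
  qed
  then show "max_count \<Lambda> n < \<infinity>" using ennreal_less_top le_less_trans by (metis infinity_ennreal_def)
next
  assume fin: "max_count \<Lambda> n < \<infinity>"
  \<comment> \<open>Adding \<open>1\<close> makes the bound positive even if \<open>\<Lambda>\<close> is empty.\<close>
  define N where "N = enn2real (max_count \<Lambda> n) + 1"
  have "max_count \<Lambda> n \<le> ennreal N"
    using fin unfolding N_def by (metis ennreal_enn2real ennreal_leI infinity_ennreal_def
        less_add_one less_imp_le)
  then have "ecount (\<Lambda> \<inter> Q H A n x) \<le> ennreal N" for x by (meson SUP_upper UNIV_I order_trans)
  moreover have "N > 0" unfolding N_def by (simp add: add_nonneg_pos)
  ultimately show "uniformly_bounded_count H A C \<Lambda> n" unfolding uniformly_bounded_count_def by blast
qed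

text \<open>The quotients defining the density are bounded by the maximal count at level \<open>0\<close>, because the power
  of the index gained in the count cancels the power of the modulus.\<close>

lemma density_finite_iff:
  assumes "haar_measure m" "emeasure m H = 1"
  shows "upper_beurling_density m H A \<Lambda> < \<infinity> \<longleftrightarrow> (\<exists>n. max_count \<Lambda> n < \<infinity>)"
proof -
  obtain F where F: "transversal F" by (rule transversal_exists)
  define r where "r = real (card F)"
  have r: "r > 0" "modulus m A = r"
    using transversal_card_pos[OF F] modulus_eq_card[OF assms(1) F assms(2)] by (auto simp: r_def)
  have dens: "upper_beurling_density m H A \<Lambda> = limsup (\<lambda>n. ennreal (1 / r ^ n) * max_count \<Lambda> (int n))"
    by (simp add: upper_beurling_density_def r)
  show ?thesis
  proof
    assume fin: "upper_beurling_density m H A \<Lambda> < \<infinity>"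
    show "\<exists>n. max_count \<Lambda> n < \<infinity>"
    proof (rule ccontr)
      assume "\<not> ?thesis"
      then have infinite: "max_count \<Lambda> (int n) = top" for n
        unfolding infinity_ennreal_def less_top[symmetric] by blast
      have "ennreal (1 / r ^ n) * max_count \<Lambda> (int n) = top" for n
        unfolding infinite using r(1) by (simp add: ennreal_mult_top)
      then have "upper_beurling_density m H A \<Lambda> = top" unfolding dens by (simp add: Limsup_const)
      then show False using fin by simp
    qed
  next
    assume "\<exists>n. max_count \<Lambda> n < \<infinity>"
    then have fin: "max_count \<Lambda> 0 < \<infinity>" using max_count_finite_iff by blast
    have "ennreal (1 / r ^ n) * max_count \<Lambda> (int n) \<le> max_count \<Lambda> 0" for n
    proof -
      have "ennreal (1 / r ^ n) * max_count \<Lambda> (int n) \<le>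
          ennreal (1 / r ^ n) * (of_nat (card F) ^ n * max_count \<Lambda> 0)"
        by (intro mult_left_mono max_count_le_power[OF F]) auto
      also have "\<dots> = (ennreal (1 / r ^ n) * ennreal (r ^ n)) * max_count \<Lambda> 0"
        using r(1) by (simp add: r_def ennreal_of_nat_eq_real_of_nat ennreal_power mult.assoc)
      also have "\<dots> = max_count \<Lambda> 0" using r(1) by (simp add: ennreal_mult[symmetric])
      finally show ?thesis .
    qed
    then have "upper_beurling_density m H A \<Lambda> \<le> max_count \<Lambda> 0"
      unfolding dens by (intro Limsup_bounded always_eventually) auto
    then show "upper_beurling_density m H A \<Lambda> < \<infinity>" using fin by (rule le_less_trans)
  qed
qed

end

section \<open>Finite density and uniformly bounded counts\<close>

theorem lemma3p0p5:
  fixes H C \<Lambda> :: "'a::{topological_ab_group_add, t2_space} set"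
    and A :: "'a \<Rightarrow> 'a"
    and m :: "'a measure"
  assumes "locally compact (UNIV :: 'a set)"
    and "add_subgroup H" and "compact H" and "open H"
    and "haar_measure m" and "emeasure m H = 1"
    and "topological_automorphism A"
    and "expansive H A"
    and "is_section H C"
  shows "(upper_beurling_density m H A \<Lambda> < \<infinity> \<longleftrightarrow> (\<exists>n. uniformly_bounded_count H A C \<Lambda> n))
    \<and> ((\<exists>n. uniformly_bounded_count H A C \<Lambda> n) \<longrightarrow> (\<forall>n. uniformly_bounded_count H A C \<Lambda> n))"
proof -
  interpret expansive_automorphism H A using assms by unfold_locales
  show ?thesis
    using density_finite_iff[OF assms(5,6)] max_count_finite_iff
    unfolding uniformly_bounded_count_iff[OF assms(9)] by blast
qed

end
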